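(* Let $n\ge 1$ and let $q_1,\ldots,q_n$ be distinct complex numbers with $\operatorname{Re} q_k>0$ for all $k$. Let $$M_n(\boldsymbol{q})=\sum_{m=-\infty}^{\infty}\prod_{k=1}^n\frac{1}{m^2+q_k^2}.$$ Then $$M_n(\boldsymbol{q})=\pi\sum_{k=1}^n\frac{\coth(\pi q_k)}{q_k}\prod_{\substack{1\le j\le n\\ j\ne k}}\frac{1}{q_j^2-q_k^2}.$$
   Context: The quantity $M_n(\boldsymbol{q})$, with $\boldsymbol{q}=(q_1,\ldots,q_n)$, is called the Matsubara sum. *)

theory Defs
  imports "HOL-Analysis.Analysis"
begin

definition coth :: "complex \<Rightarrow> complex" where
  "coth z = cosh z / sinh z"

definition matsubara_term :: "nat \<Rightarrow> (nat \<Rightarrow> complex) \<Rightarrow> int \<Rightarrow> complex" where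
  "matsubara_term n q m = (\<Prod>k=1..n. 1 / ((of_int m)\<^sup>2 + (q k)\<^sup>2))"

text \<open>
  The bilateral series is taken as an unconditional sum over the integers. \<open>infsum\<close> returns 0
  when the sum does not exist, so statements about the value should be accompanied by
  summability of \<open>matsubara_term n q\<close>.
\<close>

definition matsubara_sum :: "nat \<Rightarrow> (nat \<Rightarrow> complex) \<Rightarrow> complex" where
  "matsubara_sum n q = (\<Sum>\<^sub>\<infinity>m\<in>(UNIV :: int set). matsubara_term n q m)"

end

theory Submission
  imports Defs
begin

text \<open>
  The logarithmic derivative of the reflection formula for the Gamma function gives the
  partial fraction expansion of the cotangent, hence the case \<open>n = 1\<close>. The general case
  reduces to it, because the summand is a linear combination of the functions
  \<open>1 / (m\<^sup>2 + (q k)\<^sup>2)\<close> by partial fractions in the variable \<open>m\<^sup>2\<close>.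
\<close>

lemma Digamma_reflection_complex:
  fixes z :: complex
  assumes "z \<notin> \<int>"
  shows "Digamma (1 - z) - Digamma z = of_real pi * cot (of_real pi * z)"
proof -
  have z: "z \<notin> \<int>\<^sub>\<le>\<^sub>0" "1 - z \<notin> \<int>\<^sub>\<le>\<^sub>0"
    using assms Ints_diff[of 1 "1 - z"] nonpos_Ints_subset_Ints by auto
  \<comment> \<open>The product \<open>rGamma w * rGamma (1 - w)\<close> equals
    \<open>sin (of_real pi * w) / of_real pi\<close>. Differentiating both forms and dividing by the
    common value, nonzero off the integers, gives the claim.\<close>
  have "((\<lambda>w. rGamma w * rGamma (1 - w)) has_field_derivative
      rGamma z * rGamma (1 - z) * (Digamma (1 - z) - Digamma z)) (at z)"
    using z by (auto intro!: derivative_eq_intros simp: algebra_simps)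
  moreover have "((\<lambda>w. rGamma w * rGamma (1 - w)) has_field_derivative cos (of_real pi * z)) (at z)"
    unfolding rGamma_reflection_complex by (auto intro!: derivative_eq_intros)
  ultimately have "sin (of_real pi * z) / of_real pi * (Digamma (1 - z) - Digamma z) = cos (of_real pi * z)"
    unfolding rGamma_reflection_complex by (rule DERIV_unique)
  moreover have "sin (of_real pi * z) \<noteq> 0"
    using assms by (auto simp: sin_eq_0)
  ultimately show ?thesis
    by (simp add: cot_def field_simps)
qed

text \<open>Subtract the defining series of Digamma at \<open>1 - z\<close> and at
  \<open>z + 1\<close>: the harmonic terms and the Euler-Mascheroni constants cancel. Taking
  \<open>z + 1\<close> instead of \<open>z\<close> makes the k-th denominators multiply to
  \<open>(Suc k)\<^sup>2 - z\<^sup>2\<close>; undoing the shift costs the term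
  \<open>1 / z\<close>.\<close>

lemma cot_partial_fractions:
  fixes z :: complex
  assumes "z \<notin> \<int>"
  shows "(\<lambda>k. 2 * z / (z\<^sup>2 - (of_nat (Suc k))\<^sup>2)) sums (of_real pi * cot (of_real pi * z) - 1 / z)"
proof -
  have nz: "z \<noteq> of_int k" for k
    using assms by auto
  have nz': "z + 1 + of_nat k \<noteq> 0" "1 - z + of_nat k \<noteq> 0" for k
  proof -
    have "z + 1 + of_nat k = z - of_int (- int k - 1)" "1 - z + of_nat k = of_int (int k + 1) - z"
      by simp_all
    thus "z + 1 + of_nat k \<noteq> 0" "1 - z + of_nat k \<noteq> 0"
      using nz[of "- int k - 1"] nz[of "int k + 1"] by (metis right_minus_eq)+
  qed
  have sums: "(\<lambda>k. inverse (of_nat (Suc k)) - inverse (w + of_nat k)) sums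
      (Digamma w + euler_mascheroni)" if "w \<noteq> 0" for w :: complex
    using summable_sums[OF summable_Digamma[OF that]] by (simp add: Digamma_def)
  have "(\<lambda>k. (inverse (of_nat (Suc k)) - inverse (1 - z + of_nat k)) -
       (inverse (of_nat (Suc k)) - inverse (z + 1 + of_nat k))) sums
     ((Digamma (1 - z) + euler_mascheroni) - (Digamma (z + 1) + euler_mascheroni))"
    using nz'[of 0] by (intro sums_diff sums) auto
  moreover have "(inverse (of_nat (Suc k)) - inverse (1 - z + of_nat k)) -
       (inverse (of_nat (Suc k)) - inverse (z + 1 + of_nat k)) =
       2 * z / (z\<^sup>2 - (of_nat (Suc k))\<^sup>2)" for k
  proof -
    have "z\<^sup>2 - (of_nat (Suc k))\<^sup>2 = - ((z + 1 + of_nat k) * (1 - z + of_nat k))"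
      by (simp add: algebra_simps power2_eq_square)
    moreover have "inverse v - inverse u = (u - v) / (u * v)" if "u \<noteq> 0" "v \<noteq> 0" for u v :: complex
      using that by (simp add: field_simps)
    from this[OF nz'(2) nz'(1), of k k]
    have "inverse (z + 1 + of_nat k) - inverse (1 - z + of_nat k) =
       - 2 * z / ((z + 1 + of_nat k) * (1 - z + of_nat k))"
      by (simp add: mult.commute)
    ultimately show ?thesis by (simp del: of_nat_Suc)
  qed
  moreover have "Digamma (z + 1) = Digamma z + 1 / z"
    using nz[of 0] by (intro Digamma_plus1) auto
  ultimately show ?thesis
    using Digamma_reflection_complex[OF assms] by (simp add: algebra_simps)
qed

text \<open>Once \<open>norm c\<close> is at most half of \<open>(Suc k)\<^sup>2\<close>, the
  denominator has norm at least that half. Absolute convergence is what later turns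
  \<open>sums\<close> into the unordered \<open>has_sum\<close>.\<close>

lemma summable_norm_inverse_square_plus:
  fixes c :: "'a :: real_normed_field"
  shows "summable (\<lambda>k. norm (1 / ((of_nat (Suc k))\<^sup>2 + c)))"
proof (rule summable_comparison_test_ev)
  have "eventually (\<lambda>k. real k \<ge> 2 * norm c) at_top"
    using filterlim_real_sequentially by (auto simp: filterlim_at_top)
  thus "\<forall>\<^sub>F k in sequentially. norm (norm (1 / ((of_nat (Suc k))\<^sup>2 + c))) \<le> 2 * inverse ((real (Suc k))\<^sup>2)"
  proof eventually_elim
    case (elim k)
    have "real k \<le> (real (Suc k))\<^sup>2"
      by (simp add: power2_eq_square algebra_simps)
    hence "norm c \<le> (real (Suc k))\<^sup>2 / 2"
      using elim by linarith
    moreover have "(real (Suc k))\<^sup>2 - norm c \<le> norm ((of_nat (Suc k))\<^sup>2 + c)"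
      using norm_diff_ineq[of "(of_nat (Suc k))\<^sup>2" c]
      by (simp add: norm_power del: of_nat_Suc)
    ultimately have "(real (Suc k))\<^sup>2 / 2 \<le> norm ((of_nat (Suc k))\<^sup>2 + c)"
      by linarith
    hence "inverse (norm ((of_nat (Suc k))\<^sup>2 + c)) \<le> inverse ((real (Suc k))\<^sup>2 / 2)"
      by (intro le_imp_inverse_le) (auto simp del: of_nat_Suc)
    also have "inverse ((real (Suc k))\<^sup>2 / 2) = 2 * inverse ((real (Suc k))\<^sup>2)"
      by (metis inverse_divide divide_inverse)
    finally show ?case
      by (simp only: norm_divide norm_one real_norm_def abs_norm_cancel inverse_eq_divide abs_divide abs_one)
  qed
  show "summable (\<lambda>k. 2 * inverse ((real (Suc k))\<^sup>2))"
    using inverse_power_summable[of 2, where 'a = real]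
    by (intro summable_mult) (simp only: summable_Suc_iff[of "\<lambda>k. inverse ((real k)\<^sup>2)"])
qed

lemma has_sum_sum:
  fixes f :: "'i \<Rightarrow> 'b \<Rightarrow> 'a :: topological_comm_monoid_add"
  assumes "\<And>i. i \<in> I \<Longrightarrow> (f i has_sum S i) A"
  shows "((\<lambda>x. \<Sum>i\<in>I. f i x) has_sum (\<Sum>i\<in>I. S i)) A"
  using assms by (induction I rule: infinite_finite_induct) (auto intro: has_sum_add)

lemma has_sum_int_even:
  fixes f :: "int \<Rightarrow> 'a :: topological_ab_group_add"
  assumes even: "\<And>m. f (- m) = f m"
    and sum: "((\<lambda>k. f (int (Suc k))) has_sum S) UNIV"
  shows "(f has_sum (f 0 + S + S)) UNIV"
proof -
  let ?P = "range (\<lambda>k. int (Suc k))" and ?N = "range (\<lambda>k. - int (Suc k))"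
  have P: "(f has_sum S) ?P"
    using sum by (subst has_sum_reindex) (auto intro: injI simp: o_def)
  have N: "(f has_sum S) ?N"
    using sum by (subst has_sum_reindex) (auto intro: injI simp: o_def even simp del: of_nat_Suc)
  have "(f has_sum (f 0 + S + S)) (({0} \<union> ?P) \<union> ?N)"
    by (intro has_sum_Un_disjoint P N) (auto intro: has_sum_finiteI)
  moreover have "m \<in> ({0} \<union> ?P) \<union> ?N" for m
  proof (cases m rule: int_cases3)
    case (pos n)
    thus ?thesis by (auto intro!: image_eqI[of _ _ "n - 1"])
  \<comment> \<open>In both signs the witness is \<open>n - 1\<close>, since index \<open>k\<close>
    stands for the integer \<open>Suc k\<close> or its negative.\<close>
  next
    case (neg n)
    thus ?thesis by (auto intro!: image_eqI[of _ _ "n - 1"])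
  qed simp
  hence "({0} \<union> ?P) \<union> ?N = UNIV" by blast
  ultimately show ?thesis by simp
qed

lemma has_sum_inverse_square_plus_square:
  fixes q :: complex
  assumes "Re q > 0"
  shows "((\<lambda>m::int. 1 / ((of_int m)\<^sup>2 + q\<^sup>2)) has_sum (of_real pi * coth (of_real pi * q) / q)) UNIV"
proof -
  have q: "q \<noteq> 0" using assms by auto
  \<comment> \<open>The imaginary part of \<open>\<i> * q\<close> is \<open>Re q\<close>, which is
    positive.\<close>
  have "\<i> * q \<notin> \<int>"
  proof
    assume "\<i> * q \<in> \<int>"
    then obtain m where "\<i> * q = of_int m" by (auto elim: Ints_cases)
    hence "Im (\<i> * q) = 0" by simp
    thus False using assms by simp
  qed
  \<comment> \<open>The factor \<open>\<i> / (2 * q)\<close> turns the numerator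
    \<open>2 * (\<i> * q)\<close> into -1, which absorbs the sign of
    \<open>(\<i> * q)\<^sup>2 - (Suc k)\<^sup>2\<close>.\<close>
  from cot_partial_fractions[OF this]
  have "(\<lambda>k. \<i> / (2 * q) * (2 * (\<i> * q) / ((\<i> * q)\<^sup>2 - (of_nat (Suc k))\<^sup>2))) sums
      (\<i> / (2 * q) * (of_real pi * cot (of_real pi * (\<i> * q)) - 1 / (\<i> * q)))"
    by (rule sums_mult)
  moreover have "\<i> / (2 * q) * (2 * (\<i> * q) / ((\<i> * q)\<^sup>2 - (of_nat (Suc k))\<^sup>2)) =
      1 / ((of_nat (Suc k))\<^sup>2 + q\<^sup>2)" for k
  proof -
    have "(\<i> * q)\<^sup>2 - (of_nat (Suc k))\<^sup>2 = - ((of_nat (Suc k))\<^sup>2 + q\<^sup>2)"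
      by (simp add: power_mult_distrib)
    moreover have "\<i> / (2 * q) * (2 * (\<i> * q) / (- x)) = 1 / x" for x
      using q by simp
    ultimately show ?thesis by metis
  qed
  moreover have "cot (of_real pi * (\<i> * q)) = - \<i> * coth (of_real pi * q)"
    by (simp add: cot_def coth_def sinh_conv_sin cosh_conv_cos mult_ac)
  hence "\<i> / (2 * q) * (of_real pi * cot (of_real pi * (\<i> * q)) - 1 / (\<i> * q)) =
      (of_real pi * coth (of_real pi * q) / q - 1 / q\<^sup>2) / 2" (is "_ = ?S")
    using q by (simp add: field_simps power2_eq_square)
  ultimately have "(\<lambda>k. 1 / ((of_nat (Suc k))\<^sup>2 + q\<^sup>2)) sums ?S"
    by (simp only:)
  hence "((\<lambda>k. 1 / ((of_nat (Suc k))\<^sup>2 + q\<^sup>2)) has_sum ?S) UNIV"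
    by (intro norm_summable_imp_has_sum summable_norm_inverse_square_plus)
  \<comment> \<open>The term at 0 is \<open>1 / q\<^sup>2\<close>; it cancels the
    \<open>- 1 / q\<^sup>2\<close> contributed by the two copies of \<open>?S\<close>.\<close>
  hence "((\<lambda>m::int. 1 / ((of_int m)\<^sup>2 + q\<^sup>2)) has_sum (1 / ((of_int 0)\<^sup>2 + q\<^sup>2) + ?S + ?S)) UNIV"
    by (intro has_sum_int_even) simp_all
  thus ?thesis by (simp add: add.assoc)
qed

text \<open>Induction on \<open>A\<close>: multiply the expansion for \<open>A\<close> by the new
  factor and split each product of two fractions. The coefficients of \<open>1 / (x + a b)\<close>
  add up to the expansion for \<open>A\<close> at the point \<open>- a b\<close>, which is why
  \<open>x\<close> must be arbitrary in the induction.\<close>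

lemma prod_inverse_partial_fractions:
  fixes a :: "'i \<Rightarrow> 'a :: field"
  assumes "finite A" "A \<noteq> {}" "inj_on a A" "\<And>k. k \<in> A \<Longrightarrow> x + a k \<noteq> 0"
  shows "(\<Prod>k\<in>A. 1 / (x + a k)) = (\<Sum>k\<in>A. (\<Prod>j\<in>A - {k}. 1 / (a j - a k)) * (1 / (x + a k)))"
  using assms
proof (induction A arbitrary: x rule: finite_ne_induct)
  case (singleton k)
  thus ?case by simp
next
  case (insert b A)
  let ?P = "\<lambda>k. \<Prod>j\<in>A - {k}. 1 / (a j - a k)"
  have ne: "a k \<noteq> a b" if "k \<in> A" for k
    using inj_onD[OF insert.prems(1), of k b] insert.hyps that by auto
  have at_b: "(\<Prod>k\<in>A. 1 / (a k - a b)) = (\<Sum>k\<in>A. ?P k * (1 / (a k - a b)))"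
    using insert.IH[of "- a b"] insert.prems(1) ne by simp
  have P: "(\<Prod>j\<in>insert b A - {k}. 1 / (a j - a k)) = ?P k * (1 / (a b - a k))" if "k \<in> A" for k
  proof -
    have "insert b A - {k} = insert b (A - {k})" using insert.hyps that by auto
    thus ?thesis using insert.hyps by simp
  qed
  \<comment> \<open>The signs are arranged so that the first coefficient matches \<open>P\<close>
    and the second matches \<open>at_b\<close>.\<close>
  have split: "1 / (x + b') * (p * (1 / (x + c))) =
      p * (1 / (b' - c)) * (1 / (x + c)) + p * (1 / (c - b')) * (1 / (x + b'))"
    if "x + b' \<noteq> 0" "x + c \<noteq> 0" "c \<noteq> b'" for p b' c :: 'a
  proof -
    have "1 / (c - b') = - (1 / (b' - c))"
      by (metis minus_diff_eq minus_divide_right)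
    moreover have "1 / (x + b') * (1 / (x + c)) = 1 / (b' - c) * (1 / (x + c) - 1 / (x + b'))"
      using that by (simp add: divide_simps)
    moreover have "u * (p * v) = p * w * v + p * w' * u" if "w' = - w" "u * v = w * (v - u)" for u v w w'
      using that by algebra
    ultimately show ?thesis by blast
  qed
  have "(\<Prod>k\<in>insert b A. 1 / (x + a k)) = 1 / (x + a b) * (\<Sum>k\<in>A. ?P k * (1 / (x + a k)))"
    using insert by simp
  also have "\<dots> = (\<Sum>k\<in>A. ?P k * (1 / (a b - a k)) * (1 / (x + a k)) + ?P k * (1 / (a k - a b)) * (1 / (x + a b)))"
    unfolding sum_distrib_left by (intro sum.cong refl split) (use insert.prems ne in auto)
  also have "\<dots> = (\<Sum>k\<in>A. ?P k * (1 / (a b - a k)) * (1 / (x + a k))) +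
      (\<Prod>k\<in>A. 1 / (a k - a b)) * (1 / (x + a b))"
    unfolding at_b by (simp only: sum.distrib sum_distrib_right)
  also have "\<dots> = (\<Sum>k\<in>insert b A. (\<Prod>j\<in>insert b A - {k}. 1 / (a j - a k)) * (1 / (x + a k)))"
    using insert.hyps by (simp add: P add.commute)
  finally show ?case .
qed

text \<open>Over the complex numbers the sum factors as
  \<open>(q + \<i> * m) * (q - \<i> * m)\<close>, and both factors have real part
  \<open>Re q\<close>.\<close>

lemma of_int_square_plus_square_neq_0:
  fixes q :: complex
  assumes "Re q > 0"
  shows "(of_int m)\<^sup>2 + q\<^sup>2 \<noteq> 0"
proof
  assume "(of_int m)\<^sup>2 + q\<^sup>2 = 0"
  hence "(q + \<i> * of_int m) * (q - \<i> * of_int m) = 0"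
    by (simp add: algebra_simps power2_eq_square)
  hence "Re (q + \<i> * of_int m) = 0 \<or> Re (q - \<i> * of_int m) = 0"
    by (metis mult_eq_0_iff zero_complex.sel(1))
  thus False using assms by simp
qed

theorem theorem9p2:
  fixes n :: nat and q :: "nat \<Rightarrow> complex"
  assumes "n \<ge> 1"
    and "inj_on q {1..n}"
    and "\<And>k. k \<in> {1..n} \<Longrightarrow> Re (q k) > 0"
  shows "matsubara_term n q summable_on (UNIV :: int set) \<and>
    matsubara_sum n q =
      of_real pi * (\<Sum>k=1..n. coth (of_real pi * q k) / q k *
        (\<Prod>j\<in>{1..n} - {k}. 1 / ((q j)\<^sup>2 - (q k)\<^sup>2)))"
proof -
  let ?P = "\<lambda>k. \<Prod>j\<in>{1..n} - {k}. 1 / ((q j)\<^sup>2 - (q k)\<^sup>2)"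
  \<comment> \<open>Partial fractions in \<open>m\<^sup>2\<close> need distinct squares; positive
    real parts exclude \<open>q i = - q j\<close>.\<close>
  have inj: "inj_on (\<lambda>k. (q k)\<^sup>2) {1..n}"
  proof (rule inj_onI)
    fix i j assume ij: "i \<in> {1..n}" "j \<in> {1..n}" "(q i)\<^sup>2 = (q j)\<^sup>2"
    hence "q i = q j \<or> q i = - q j" by (simp add: power2_eq_iff)
    moreover have "q i \<noteq> - q j"
    proof
      assume "q i = - q j"
      hence "Re (q i) = - Re (q j)" by simp
      thus False using assms(3)[OF ij(1)] assms(3)[OF ij(2)] by linarith
    qed
    ultimately show "i = j" using ij assms(2) by (auto dest: inj_onD)
  qed
  have "matsubara_term n q = (\<lambda>m. \<Sum>k=1..n. ?P k * (1 / ((of_int m)\<^sup>2 + (q k)\<^sup>2)))"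
    unfolding matsubara_term_def
    using assms(1,3) of_int_square_plus_square_neq_0 inj
    by (intro ext prod_inverse_partial_fractions) auto
  moreover have "((\<lambda>m::int. \<Sum>k=1..n. ?P k * (1 / ((of_int m)\<^sup>2 + (q k)\<^sup>2))) has_sum
      (\<Sum>k=1..n. ?P k * (of_real pi * coth (of_real pi * q k) / q k))) UNIV"
    using assms(3) by (intro has_sum_sum has_sum_cmult_right has_sum_inverse_square_plus_square) auto
  moreover have "(\<Sum>k=1..n. ?P k * (of_real pi * coth (of_real pi * q k) / q k)) =
      of_real pi * (\<Sum>k=1..n. coth (of_real pi * q k) / q k * ?P k)"
    by (simp add: sum_distrib_left mult_ac)
  \<comment> \<open>A single \<open>has_sum\<close> fact yields both conjuncts, so the value is not
    the default 0 of \<open>infsum\<close>.\<close>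
  ultimately have "(matsubara_term n q has_sum
      of_real pi * (\<Sum>k=1..n. coth (of_real pi * q k) / q k * ?P k)) UNIV"
    by (simp only:)
  thus ?thesis
    unfolding matsubara_sum_def by (blast intro: has_sum_imp_summable infsumI)
qed

end
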